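(* The inner product matrix $H\in\mathbb{R}^{L\times L}$, with entries $H_{\alpha,\beta}=\langle w_\alpha,w_\beta\rangle$ for $\alpha,\beta\in\mathbb{I}$, has three distinct eigenvalues: $2$, $n$ and $2n$, with multiplicity $L-n$, $n-1$ and $1$ respectively.
   Context: Let $n$ be the number of points under consideration, and let $\mathbb{I}=\{(i,j):1\le i<j\le n\}$, which has size $L=\binom{n}{2}=n(n-1)/2$. Let $e_{i,j}\in\mathbb{R}^{n\times n}$ be the matrix whose only nonzero entry is a $1$ at position $(i,j)$. For $\alpha=(\alpha_1,\alpha_2)\in\mathbb{I}$ define $w_\alpha=e_{\alpha_1,\alpha_1}+e_{\alpha_2,\alpha_2}-e_{\alpha_1,\alpha_2}-e_{\alpha_2,\alpha_1}$. $\langle X,Y\rangle=\operatorname{trace}(X^\top Y)$ is the trace inner product.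
   Formalization: n ≥ 3 is assumed, since for n = 1, 2 the claim fails (for n = 2, H = (4) and L − n = −1); for n = 3 the multiplicity of 2 is L − n = 0, so only n and 2n are eigenvalues, and there are three distinct eigenvalues exactly for n ≥ 4. *)

theory Defs
  imports "Jordan_Normal_Form.Spectral_Radius"
begin

definition index_pairs :: "nat \<Rightarrow> (nat \<times> nat) set" where
  "index_pairs n = {(i, j). 1 \<le> i \<and> i < j \<and> j \<le> n}"

(* Points are numbered from 1, whereas the entries of a matrix are numbered from 0. *)
definition e_mat :: "nat \<Rightarrow> nat \<Rightarrow> nat \<Rightarrow> real mat" where
  "e_mat n i j = mat n n (\<lambda>(r, c). if Suc r = i \<and> Suc c = j then 1 else 0)"

definition w_mat :: "nat \<Rightarrow> nat \<times> nat \<Rightarrow> real mat" where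
  "w_mat n \<alpha> = (case \<alpha> of (i, j) \<Rightarrow> e_mat n i i + e_mat n j j - e_mat n i j - e_mat n j i)"

definition mat_trace :: "real mat \<Rightarrow> real" where
  "mat_trace A = (\<Sum>i<dim_row A. A $$ (i, i))"

definition trace_inner :: "real mat \<Rightarrow> real mat \<Rightarrow> real" where
  "trace_inner X Y = mat_trace (X\<^sup>T * Y)"

(* The rows and columns of H are labelled by index_pairs n; the argument enum lists
   these labels as enum 0, ..., enum (L - 1). *)
definition H_mat :: "nat \<Rightarrow> (nat \<Rightarrow> nat \<times> nat) \<Rightarrow> real mat" where
  "H_mat n enum = mat (n choose 2) (n choose 2)
     (\<lambda>(a, b). trace_inner (w_mat n (enum a)) (w_mat n (enum b)))"

definition eig_mult :: "real mat \<Rightarrow> real \<Rightarrow> nat" where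
  "eig_mult A k = Polynomial.order k (char_poly A)"

end

theory Submission
  imports Defs
begin

text \<open>
  Each \<open>w\<^sub>\<alpha>\<close> with \<open>\<alpha> = (i, j)\<close> is the rank-one matrix \<open>v v\<^sup>T\<close> for
  \<open>v = e\<^sub>i - e\<^sub>j\<close>, so \<open>\<langle>w\<^sub>\<alpha>, w\<^sub>\<beta>\<rangle>\<close> is the square of the inner product of the vectors
  belonging to \<open>\<alpha>\<close> and \<open>\<beta>\<close>. It is 4, 1 or 0 according as the two pairs share 2, 1 or 0
  points. Squaring removes the signs: with the unsigned point-pair incidence matrix \<open>U\<close>
  (of size \<open>n \<times> L\<close>) this says \<open>H = U\<^sup>T U + 2 I\<close> (\<open>H_mat_eq_gram\<close>).

  The small product \<open>U U\<^sup>T\<close> counts pairs through two given points, whence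
  \<open>U U\<^sup>T = J + (n - 2) I\<close> with \<open>J\<close> the all-ones matrix (\<open>incidence_mat_times_transpose\<close>).
  The matrices \<open>A B\<close> and \<open>B A\<close> have the same characteristic polynomial up to a power of the
  variable (\<open>char_poly_mult_swap\<close>). This is used twice: for \<open>J = 1 1\<^sup>T\<close> against the
  \<open>1 \<times> 1\<close> matrix \<open>1\<^sup>T 1 = (n)\<close>, and for \<open>U\<^sup>T U\<close> against \<open>U U\<^sup>T\<close>. As adding a
  multiple of the identity only shifts the variable, the characteristic polynomial of \<open>H\<close> is
  \<open>(x - 2)\<^bsup>L - n\<^esup> (x - n)\<^bsup>n - 1\<^esup> (x - 2 n)\<close> (\<open>char_poly_H_mat\<close>), from which multiplicities
  and spectrum can be read off. For \<open>n = 3\<close> one has \<open>L = n\<close>, and the eigenvalue 2 is absent.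
\<close>

section \<open>Characteristic polynomials of products and shifts\<close>

lemma char_poly_block_lower_triangular:
  fixes A :: "'a :: idom mat"
  assumes A: "A \<in> carrier_mat n n" and C: "C \<in> carrier_mat m n" and D: "D \<in> carrier_mat m m"
  shows "char_poly (four_block_mat A (0\<^sub>m n m) C D) = char_poly A * char_poly D"
proof -
  have "char_poly_matrix (four_block_mat A (0\<^sub>m n m) C D)
      = four_block_mat (char_poly_matrix A) (0\<^sub>m n m) (map_mat (\<lambda>a. [:- a:]) C) (char_poly_matrix D)"
    by (rule eq_matI) (use A C D in \<open>auto simp: char_poly_matrix_def\<close>)
  then show ?thesis
    unfolding char_poly_def
    by (simp add: det_four_block_mat_upper_right_zero[of _ n _ m] A C D)
qed

lemma char_poly_zero_mat: "char_poly (0\<^sub>m n n :: 'a :: idom mat) = [:0, 1:] ^ n"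
proof -
  have "diag_mat (0\<^sub>m n n :: 'a mat) = replicate n 0"
    by (rule nth_equalityI) (auto simp: diag_mat_def)
  then show ?thesis
    by (subst char_poly_upper_triangular[of _ n]) (auto simp: prod_list_replicate)
qed

text \<open>
  Over the block size \<open>n + m\<close> the two products become similar: conjugation by the unipotent
  matrix with upper right block \<open>A\<close> carries the block matrix with rows \<open>(0, 0)\<close>,
  \<open>(B, B A)\<close> to the one with rows \<open>(A B, 0)\<close>, \<open>(B, 0)\<close>. The zero diagonal blocks
  account for the powers of the variable.
\<close>

lemma char_poly_mult_swap:
  fixes A B :: "'a :: idom mat"
  assumes A: "A \<in> carrier_mat n m" and B: "B \<in> carrier_mat m n"
  shows "char_poly (A * B) * [:0, 1:] ^ m = [:0, 1:] ^ n * char_poly (B * A)"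
proof -
  let ?M = "four_block_mat (A * B) (0\<^sub>m n m) B (0\<^sub>m m m)"
  let ?N = "four_block_mat (0\<^sub>m n n) (0\<^sub>m n m) B (B * A)"
  let ?P = "four_block_mat (1\<^sub>m n) A (0\<^sub>m m n) (1\<^sub>m m)"
  let ?Q = "four_block_mat (1\<^sub>m n) (- A) (0\<^sub>m m n) (1\<^sub>m m)"
  have one: "four_block_mat (1\<^sub>m n) (0\<^sub>m n m) (0\<^sub>m m n) (1\<^sub>m m) = (1\<^sub>m (n + m) :: 'a mat)"
    by (rule eq_matI) auto
  have neg_zero: "- (0\<^sub>m m m) = (0\<^sub>m m m :: 'a mat)"
    by (rule eq_matI) auto
  have add_neg: "A + - A = 0\<^sub>m n m"
    by (rule eq_matI) (use A in auto)
  have PQ: "?P * ?Q = 1\<^sub>m (n + m)"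
    by (subst mult_four_block_mat[of _ n n _ m _ m _ _ n _ m])
       (use A in \<open>auto simp: one neg_zero uminus_l_inv_mat\<close>)
  have QP: "?Q * ?P = 1\<^sub>m (n + m)"
    by (subst mult_four_block_mat[of _ n n _ m _ m _ _ n _ m])
       (use A in \<open>auto simp: one add_neg\<close>)
  have PN: "?P * ?N = four_block_mat (A * B) (A * B * A) B (B * A)"
    by (subst mult_four_block_mat[of _ n n _ m _ m _ _ n _ m]) (use A B in auto)
  have "?P * ?N * ?Q = ?M"
    unfolding PN
    by (subst mult_four_block_mat[of _ n n _ m _ m _ _ n _ m]) (use A B in auto)
  then have "similar_mat ?M ?N"
    using A B PQ QP by (intro similar_matI[of _ _ ?P ?Q "n + m"]) auto
  then have "char_poly ?M = char_poly ?N"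
    by (rule char_poly_similar)
  then show ?thesis
    using A B by (simp add: char_poly_block_lower_triangular char_poly_zero_mat)
qed

lemma char_poly_add_scalar_mat:
  fixes A :: "'a :: idom mat"
  assumes A: "A \<in> carrier_mat n n"
  shows "char_poly (A + c \<cdot>\<^sub>m 1\<^sub>m n) = char_poly A \<circ>\<^sub>p [:- c, 1:]"
proof -
  have "char_poly_matrix (A + c \<cdot>\<^sub>m 1\<^sub>m n)
      = map_mat (\<lambda>p. p \<circ>\<^sub>p [:- c, 1:]) (char_poly_matrix A)"
    by (rule eq_matI) (use A in \<open>auto simp: char_poly_matrix_def pcompose_pCons\<close>)
  moreover have "comm_ring_hom (\<lambda>p. p \<circ>\<^sub>p [:- c, 1:])"
    by (rule pcompose_hom.comm_ring_hom_axioms)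
  ultimately show ?thesis
    unfolding char_poly_def by (simp add: comm_ring_hom.hom_det)
qed

text \<open>
  The all-ones matrix is a column of ones times a row of ones; the product in the other order is
  the \<open>1 \<times> 1\<close> matrix with entry \<open>n\<close>.
\<close>

lemma char_poly_all_ones:
  assumes "0 < n"
  shows "char_poly (mat n n (\<lambda>_. 1) :: real mat) = [:0, 1:] ^ (n - 1) * [:- real n, 1:]"
proof -
  let ?u = "mat n 1 (\<lambda>_. 1) :: real mat" and ?v = "mat 1 n (\<lambda>_. 1) :: real mat"
  have J: "?u * ?v = mat n n (\<lambda>_. 1)"
    by (rule eq_matI) (auto simp: scalar_prod_def)
  have vu: "?v * ?u = mat 1 1 (\<lambda>_. real n)"
    by (rule eq_matI) (auto simp: scalar_prod_def)
  have single: "char_poly (mat 1 1 (\<lambda>_. real n)) = [:- real n, 1:]"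
    by (subst char_poly_upper_triangular[of _ 1]) (auto simp: diag_mat_def)
  have "char_poly (mat n n (\<lambda>_. 1) :: real mat) * [:0, 1:]
      = [:0, 1:] ^ n * [:- real n, 1:]"
    using char_poly_mult_swap[of ?u n 1 ?v] unfolding J vu single by simp
  also have "\<dots> = ([:0, 1:] ^ (n - 1) * [:- real n, 1:]) * [:0, 1:]"
    using power_minus_mult[OF assms, of "[:0, 1:] :: real poly"]
    by (metis mult.assoc mult.commute)
  finally show ?thesis
    by (subst (asm) mult_right_cancel) auto
qed

section \<open>The incidence matrix of points and pairs\<close>

text \<open>
  The two points of a pair are distinct, so an entry is 0 or 1; a sum rather than a disjunction
  lets products of columns expand bilinearly.
\<close>

definition incidence_mat :: "nat \<Rightarrow> nat \<Rightarrow> (nat \<Rightarrow> nat \<times> nat) \<Rightarrow> real mat" where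
  "incidence_mat n L enum =
     mat n L (\<lambda>(r, a). of_bool (Suc r = fst (enum a)) + of_bool (Suc r = snd (enum a)))"

lemma incidence_mat_carrier [simp]: "incidence_mat n L enum \<in> carrier_mat n L"
  by (simp add: incidence_mat_def)

lemma w_mat_rank_one:
  assumes "r < n" "c < n"
  shows "w_mat n \<alpha> $$ (r, c) =
    (of_bool (Suc r = fst \<alpha>) - of_bool (Suc r = snd \<alpha>)) *
    (of_bool (Suc c = fst \<alpha>) - of_bool (Suc c = snd \<alpha>))"
proof (cases \<alpha>)
  case (Pair i j)
  have "e_mat n p q $$ (r, c) = of_bool (Suc r = p) * of_bool (Suc c = q)"
    and "dim_row (e_mat n p q) = n" and "dim_col (e_mat n p q) = n" for p q
    using assms by (simp_all add: e_mat_def)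
  then show ?thesis
    using assms by (simp add: Pair w_mat_def left_diff_distrib right_diff_distrib del: of_bool_conj)
qed

lemma w_mat_carrier: "w_mat n \<alpha> \<in> carrier_mat n n"
  by (cases \<alpha>) (auto simp: w_mat_def e_mat_def)

lemma trace_inner_eq_sum:
  assumes X: "X \<in> carrier_mat n m" and Y: "Y \<in> carrier_mat n m"
  shows "trace_inner X Y = (\<Sum>c<m. \<Sum>r<n. X $$ (r, c) * Y $$ (r, c))"
  using assms
  by (auto simp: trace_inner_def mat_trace_def scalar_prod_def atLeast0LessThan intro!: sum.cong)

lemma sum_indicator_product:
  assumes "1 \<le> i" "i \<le> n"
  shows "(\<Sum>r<n. of_bool (Suc r = i) * of_bool (Suc r = k)) = (of_bool (i = k) :: real)"
proof -
  have "(\<Sum>r<n. of_bool (Suc r = i) * of_bool (Suc r = k))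
      = (\<Sum>r<n. if r = i - 1 then of_bool (i = k) else (0 :: real))"
    by (rule sum.cong) (use assms in auto)
  moreover have "i - 1 < n"
    using assms by linarith
  ultimately show ?thesis
    by simp
qed

text \<open>
  Let \<open>\<alpha> = (i, j)\<close> and \<open>\<beta> = (k, l)\<close>. The left-hand side is \<open>(v\<^sub>\<alpha> \<bullet> v\<^sub>\<beta>)\<^sup>2\<close> for the signed incidence vectors, the sum on the
  right is the inner product of the unsigned ones. Because \<open>i < j\<close> and \<open>k < l\<close>, at most one
  of the four coincidences between \<open>i, j\<close> and \<open>k, l\<close> occurs unless \<open>\<alpha> = \<beta>\<close>, so the two
  sides agree off the diagonal; on the diagonal they are \<open>2\<^sup>2\<close> and \<open>2\<close>.
\<close>

lemma trace_inner_w_mat: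
  assumes \<alpha>: "\<alpha> \<in> index_pairs n" and \<beta>: "\<beta> \<in> index_pairs n"
  shows "trace_inner (w_mat n \<alpha>) (w_mat n \<beta>) =
    (\<Sum>r<n. (of_bool (Suc r = fst \<alpha>) + of_bool (Suc r = snd \<alpha>)) *
            (of_bool (Suc r = fst \<beta>) + of_bool (Suc r = snd \<beta>)))
    + 2 * of_bool (\<alpha> = \<beta>)"
proof -
  obtain i j where ij: "\<alpha> = (i, j)" "1 \<le> i" "i < j" "j \<le> n"
    using \<alpha> by (auto simp: index_pairs_def)
  obtain k l where kl: "\<beta> = (k, l)" "1 \<le> k" "k < l" "l \<le> n"
    using \<beta> by (auto simp: index_pairs_def)
  let ?s = "\<lambda>r. (of_bool (Suc r = i) - of_bool (Suc r = j)) *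
                (of_bool (Suc r = k) - of_bool (Suc r = l)) :: real"
  let ?t = "\<lambda>r. (of_bool (Suc r = i) + of_bool (Suc r = j)) *
                (of_bool (Suc r = k) + of_bool (Suc r = l)) :: real"
  have "trace_inner (w_mat n \<alpha>) (w_mat n \<beta>) = (\<Sum>c<n. \<Sum>r<n. ?s r * ?s c)"
    unfolding trace_inner_eq_sum[OF w_mat_carrier w_mat_carrier]
    by (intro sum.cong refl) (simp add: w_mat_rank_one ij kl)
  also have "\<dots> = (\<Sum>r<n. ?s r)\<^sup>2"
    unfolding power2_eq_square sum_product by (subst sum.swap) (rule refl)
  also have "(\<Sum>r<n. ?s r) = of_bool (i = k) - of_bool (i = l) - (of_bool (j = k) - of_bool (j = l))"
    using ij kl by (simp only: left_diff_distrib right_diff_distrib sum_subtractf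
        sum_indicator_product)
  \<comment> \<open>A finite case distinction on the four coincidences; the orderings exclude \<open>(k, l) = (j, i)\<close>,
      the only configuration in which the signed inner product would be \<open>-2\<close>.\<close>
  also have "(\<dots>)\<^sup>2 = of_bool (i = k) + of_bool (i = l) + (of_bool (j = k) + of_bool (j = l))
      + 2 * of_bool (\<alpha> = \<beta>)"
    using ij kl by auto
  also have "of_bool (i = k) + of_bool (i = l) + (of_bool (j = k) + of_bool (j = l)) = (\<Sum>r<n. ?t r)"
    using ij kl by (simp only: distrib_left distrib_right sum.distrib sum_indicator_product)
  finally show ?thesis
    by (simp add: ij kl)
qed

lemma H_mat_eq_gram:
  assumes enum: "bij_betw enum {..<L} (index_pairs n)" and L: "L = n choose 2"
  shows "H_mat n enum =
    (incidence_mat n L enum)\<^sup>T * incidence_mat n L enum + 2 \<cdot>\<^sub>m 1\<^sub>m L"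
proof (rule eq_matI)
  fix a b
  assume "a < dim_row ((incidence_mat n L enum)\<^sup>T * incidence_mat n L enum + 2 \<cdot>\<^sub>m 1\<^sub>m L)"
    and "b < dim_col ((incidence_mat n L enum)\<^sup>T * incidence_mat n L enum + 2 \<cdot>\<^sub>m 1\<^sub>m L)"
  then have ab: "a < L" "b < L"
    by auto
  then have "enum a \<in> index_pairs n" "enum b \<in> index_pairs n"
    using enum by (auto simp: bij_betw_def)
  moreover have "enum a = enum b \<longleftrightarrow> a = b"
    using enum ab by (auto simp: bij_betw_def inj_on_def)
  ultimately have H: "H_mat n enum $$ (a, b) =
    (\<Sum>r<n. (of_bool (Suc r = fst (enum a)) + of_bool (Suc r = snd (enum a))) *
            (of_bool (Suc r = fst (enum b)) + of_bool (Suc r = snd (enum b))))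
    + 2 * of_bool (a = b)"
    using ab by (simp only: H_mat_def L[symmetric] index_mat split trace_inner_w_mat)
  have "((incidence_mat n L enum)\<^sup>T * incidence_mat n L enum) $$ (a, b) =
    (\<Sum>r<n. (of_bool (Suc r = fst (enum a)) + of_bool (Suc r = snd (enum a))) *
            (of_bool (Suc r = fst (enum b)) + of_bool (Suc r = snd (enum b))))"
    using ab by (simp add: incidence_mat_def scalar_prod_def atLeast0LessThan)
  then show "H_mat n enum $$ (a, b) =
      ((incidence_mat n L enum)\<^sup>T * incidence_mat n L enum + 2 \<cdot>\<^sub>m 1\<^sub>m L) $$ (a, b)"
    using ab H by simp
qed (simp_all add: H_mat_def L incidence_mat_def)

lemma pairs_through_point:
  assumes p: "1 \<le> p" "p \<le> n"
  shows "card {\<alpha> \<in> index_pairs n. p = fst \<alpha> \<or> p = snd \<alpha>} = n - 1"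
proof -
  have "{\<alpha> \<in> index_pairs n. p = fst \<alpha> \<or> p = snd \<alpha>}
      = (\<lambda>q. (q, p)) ` {1..<p} \<union> Pair p ` {p<..n}"
    using p by (auto simp: index_pairs_def)
  moreover have "card ((\<lambda>q. (q, p)) ` {1..<p} \<union> Pair p ` {p<..n})
      = card ((\<lambda>q. (q, p)) ` {1..<p}) + card (Pair p ` {p<..n})"
    by (rule card_Un_disjoint) auto
  ultimately show ?thesis
    using p by (simp add: card_image inj_on_def)
qed

lemma pairs_through_two_points:
  assumes "1 \<le> p" "p \<le> n" "1 \<le> q" "q \<le> n" "p \<noteq> q"
  shows "{\<alpha> \<in> index_pairs n. (p = fst \<alpha> \<or> p = snd \<alpha>) \<and> (q = fst \<alpha> \<or> q = snd \<alpha>)}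
    = {(min p q, max p q)}"
  using assms by (cases "p < q") (auto simp: index_pairs_def)

text \<open>
  The entry at two points is the number of pairs containing both: \<open>n - 1\<close> if they coincide,
  which is \<open>1 + (n - 2)\<close>, and 1 otherwise.
\<close>

lemma incidence_mat_times_transpose:
  assumes enum: "bij_betw enum {..<L} (index_pairs n)"
  shows "incidence_mat n L enum * (incidence_mat n L enum)\<^sup>T
    = mat n n (\<lambda>_. 1) + (real n - 2) \<cdot>\<^sub>m 1\<^sub>m n"
proof (rule eq_matI)
  fix r s
  assume "r < dim_row (mat n n (\<lambda>_. 1) + (real n - 2) \<cdot>\<^sub>m 1\<^sub>m n)"
    and "s < dim_col (mat n n (\<lambda>_. 1) + (real n - 2) \<cdot>\<^sub>m 1\<^sub>m n)"
  then have rs: "r < n" "s < n"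
    by auto
  let ?f = "\<lambda>\<alpha>. (of_bool (Suc r = fst \<alpha>) + of_bool (Suc r = snd \<alpha>)) *
                (of_bool (Suc s = fst \<alpha>) + of_bool (Suc s = snd \<alpha>)) :: real"
  let ?S = "{\<alpha> \<in> index_pairs n. (Suc r = fst \<alpha> \<or> Suc r = snd \<alpha>) \<and>
                                 (Suc s = fst \<alpha> \<or> Suc s = snd \<alpha>)}"
  have fin: "finite (index_pairs n)"
    using enum bij_betw_finite by blast
  have "(incidence_mat n L enum * (incidence_mat n L enum)\<^sup>T) $$ (r, s) = (\<Sum>a<L. ?f (enum a))"
    using rs by (simp add: incidence_mat_def scalar_prod_def atLeast0LessThan)
  also have "\<dots> = (\<Sum>\<alpha>\<in>index_pairs n. ?f \<alpha>)"
    by (rule sum.reindex_bij_betw[OF enum])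
  also have "\<dots> = (\<Sum>\<alpha>\<in>index_pairs n. if \<alpha> \<in> ?S then 1 else 0)"
    by (rule sum.cong) (auto simp: index_pairs_def)
  also have "\<dots> = real (card ?S)"
    using fin by (simp add: sum.If_cases Int_def)
  also have "\<dots> = (mat n n (\<lambda>_. 1) + (real n - 2) \<cdot>\<^sub>m 1\<^sub>m n) $$ (r, s)"
  proof (cases "r = s")
    case True
    then show ?thesis
      using rs pairs_through_point[of "Suc r" n] by simp
  next
    case False
    then show ?thesis
      using rs pairs_through_two_points[of "Suc r" n "Suc s"] by simp
  qed
  finally show "(incidence_mat n L enum * (incidence_mat n L enum)\<^sup>T) $$ (r, s) =
      (mat n n (\<lambda>_. 1) + (real n - 2) \<cdot>\<^sub>m 1\<^sub>m n) $$ (r, s)" .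
qed (simp_all add: incidence_mat_def)

section \<open>The spectrum of the inner product matrix\<close>

lemma le_choose_two:
  assumes "3 \<le> (n :: nat)"
  shows "n \<le> n choose 2"
proof -
  have "n * 2 \<le> n * (n - 1)"
    using assms by (intro mult_le_mono2) linarith
  then show ?thesis
    unfolding choose_two by linarith
qed

lemma less_choose_two:
  assumes "4 \<le> (n :: nat)"
  shows "n < n choose 2"
proof -
  have "n * 3 \<le> n * (n - 1)"
    using assms by (intro mult_le_mono2) linarith
  then show ?thesis
    using assms unfolding choose_two by linarith
qed

text \<open>
  The factor \<open>x\<^bsup>L - n\<^esup>\<close> that \<open>U\<^sup>T U\<close> gains over \<open>U U\<^sup>T\<close> turns into the eigenvalue 2 after
  the shift, while the eigenvalues \<open>n - 2\<close> and \<open>2 n - 2\<close> of \<open>U U\<^sup>T\<close> turn into \<open>n\<close> and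
  \<open>2 n\<close>.
\<close>

lemma char_poly_H_mat:
  assumes n: "3 \<le> n" and L: "L = n choose 2" and enum: "bij_betw enum {..<L} (index_pairs n)"
  shows "char_poly (H_mat n enum) =
    [:- 2, 1:] ^ (L - n) * [:- real n, 1:] ^ (n - 1) * [:- (2 * real n), 1:]"
proof -
  let ?U = "incidence_mat n L enum"
  let ?X = "[:0, 1:] :: real poly"
  have shift: "[:a, 1:] \<circ>\<^sub>p [:c, 1:] = [:a + c, 1:]" for a c :: real
    by (simp add: pcompose_pCons)
  have nL: "n \<le> L"
    using le_choose_two[OF n] L by simp
  have "char_poly (?U * ?U\<^sup>T) = (?X ^ (n - 1) * [:- real n, 1:]) \<circ>\<^sub>p [:- (real n - 2), 1:]"
    using n by (simp only: incidence_mat_times_transpose[OF enum] mat_carrier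
        char_poly_add_scalar_mat[of _ n] char_poly_all_ones)
  also have "\<dots> = [:- (real n - 2), 1:] ^ (n - 1) * [:- (2 * real n - 2), 1:]"
    unfolding pcompose_hom.hom_mult pcompose_hom.hom_power shift by (simp add: algebra_simps)
  finally have UUt: "char_poly (?U * ?U\<^sup>T)
      = [:- (real n - 2), 1:] ^ (n - 1) * [:- (2 * real n - 2), 1:]" .
  have "char_poly (?U\<^sup>T * ?U) * ?X ^ n = ?X ^ L * char_poly (?U * ?U\<^sup>T)"
    by (rule char_poly_mult_swap) simp_all
  also have "\<dots> = (?X ^ (L - n) * char_poly (?U * ?U\<^sup>T)) * ?X ^ n"
    using nL by (simp add: mult_ac power_add[symmetric])
  finally have "char_poly (?U\<^sup>T * ?U) = ?X ^ (L - n) * char_poly (?U * ?U\<^sup>T)"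
    by (subst (asm) mult_right_cancel) auto
  then have "char_poly (H_mat n enum) = (?X ^ (L - n) * char_poly (?U * ?U\<^sup>T)) \<circ>\<^sub>p [:- 2, 1:]"
    using char_poly_add_scalar_mat[of "?U\<^sup>T * ?U" L 2]
      mult_carrier_mat[of "?U\<^sup>T" L n ?U L]
    by (simp add: H_mat_eq_gram[OF enum L])
  also have "\<dots> = [:- 2, 1:] ^ (L - n) * [:- real n, 1:] ^ (n - 1) * [:- (2 * real n), 1:]"
  proof -
    have "0 + - 2 = (- 2 :: real)" and "- (real n - 2) + - 2 = - real n"
      and "- (2 * real n - 2) + - 2 = - (2 * real n)"
      by simp_all
    then show ?thesis
      unfolding UUt pcompose_hom.hom_mult pcompose_hom.hom_power shift by (simp only: mult.assoc)
  qed
  finally show ?thesis .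
qed

theorem corollary2:
  fixes n L :: nat and enum :: "nat \<Rightarrow> nat \<times> nat" and H :: "real mat"
  assumes "n \<ge> 3"
    and "L = n choose 2"
    and "bij_betw enum {..<L} (index_pairs n)"
    and "H = H_mat n enum"
  shows "distinct [2, real n, 2 * real n]
    \<and> int (eig_mult H 2) = int L - int n
    \<and> int (eig_mult H (real n)) = int n - 1
    \<and> eig_mult H (2 * real n) = 1
    \<and> spectrum H = (if n = 3 then {real n, 2 * real n} else {2, real n, 2 * real n})"
proof -
  have cp: "char_poly H =
      [:- 2, 1:] ^ (L - n) * [:- real n, 1:] ^ (n - 1) * [:- (2 * real n), 1:]"
    using char_poly_H_mat assms by simp
  have mult: "eig_mult H k = (if k = 2 then L - n else 0) + (if k = real n then n - 1 else 0)
      + (if k = 2 * real n then 1 else 0)" for k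
  proof -
    have "eig_mult H k = order k ([:- 2, 1:] ^ (L - n)) + order k ([:- real n, 1:] ^ (n - 1))
        + order k [:- (2 * real n), 1:]"
      unfolding eig_mult_def cp
      by (subst order_mult, simp only: mult_eq_0_iff power_eq_0_iff, simp)+ (rule refl)
    then show ?thesis
      by (simp only: order_linear_power order_linear' minus_equation_iff[of _ k]
          minus_minus eq_commute[of _ k] neg_equal_iff_equal)
  qed
  have nL: "n \<le> L"
    using le_choose_two assms by simp
  have L_eq: "L = n \<longleftrightarrow> n = 3"
    using less_choose_two[of n] assms(1,2) by (cases "n = 3") (auto simp: choose_two)
  have "H \<in> carrier_mat L L"
    using assms by (simp add: H_mat_def)
  then have "spectrum H = {k. poly (char_poly H) k = 0}"
    by (rule spectrum_root_char_poly)
  \<comment> \<open>The factor belonging to 2 is constant exactly when \<open>L = n\<close>, that is, when \<open>n = 3\<close>.\<close>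
  also have "\<dots> = {k. (k = 2 \<and> n \<noteq> 3) \<or> k = real n \<or> k = 2 * real n}"
    using assms(1) nL L_eq by (auto simp: cp)
  finally show ?thesis
    using assms(1) nL by (auto simp: mult)
qed

end
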